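(* For every positive integer $n$ we have $\mathrm{Int}_{\mathbb{Q}}(A_n,\mathcal{A}_n)=\mathrm{Int}_{\mathbb{Q}}(\mathcal{A}_n)$.
   Context: Fix an algebraic closure $\overline{\mathbb{Q}}$ of $\mathbb{Q}$. For a positive integer $n$, $\mathcal{A}_n\subset\overline{\mathbb{Q}}$ denotes the set of all algebraic integers of degree less than or equal to $n$ over $\mathbb{Q}$, and $A_n\subseteq\mathcal{A}_n$ denotes the subset of those of degree exactly $n$. Define $\mathrm{Int}_{\mathbb{Q}}(\mathcal{A}_n)=\{f\in\mathbb{Q}[X]\mid f(\mathcal{A}_n)\subset\mathcal{A}_n\}$ and $\mathrm{Int}_{\mathbb{Q}}(A_n,\mathcal{A}_n)=\{f\in\mathbb{Q}[X]\mid f(A_n)\subset\mathcal{A}_n\}$. *)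

theory Defs
  imports "HOL-Computational_Algebra.Computational_Algebra"
begin

abbreviation rat_poly_eval :: "rat poly \<Rightarrow> 'a :: field_char_0 \<Rightarrow> 'a" where
  "rat_poly_eval f x \<equiv> poly (map_poly of_rat f) x"

lemma map_poly_of_rat_add:
  "map_poly of_rat (p + q) = map_poly of_rat p + (map_poly of_rat q :: 'a :: field_char_0 poly)"
  by (simp add: poly_eq_iff coeff_map_poly of_rat_add)

lemma map_poly_of_rat_mult:
  "map_poly of_rat (p * q) = map_poly of_rat p * (map_poly of_rat q :: 'a :: field_char_0 poly)"
  by (simp add: poly_eq_iff coeff_map_poly coeff_mult of_rat_sum of_rat_mult)

lemma rat_poly_eval_add: "rat_poly_eval (p + q) x = rat_poly_eval p x + rat_poly_eval q x"
  by (simp add: map_poly_of_rat_add)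

lemma rat_poly_eval_mult: "rat_poly_eval (p * q) x = rat_poly_eval p x * rat_poly_eval q x"
  by (simp add: map_poly_of_rat_mult)

text \<open>
  The minimal polynomial over the rationals; it is well defined for algebraic \<open>x\<close> by
  \<open>min_poly_rat_ex1\<close> below and unspecified otherwise.
\<close>

definition is_min_poly_rat :: "rat poly \<Rightarrow> 'a :: field_char_0 \<Rightarrow> bool" where
  "is_min_poly_rat p x \<longleftrightarrow> lead_coeff p = 1 \<and> irreducible p \<and> rat_poly_eval p x = 0"

definition min_poly_rat :: "'a :: field_char_0 \<Rightarrow> rat poly" where
  "min_poly_rat x = (THE p. is_min_poly_rat p x)"

definition degree_over_rat :: "'a :: field_char_0 \<Rightarrow> nat" where
  "degree_over_rat x = degree (min_poly_rat x)"

definition alg_ints_degree_le :: "nat \<Rightarrow> 'a :: field_char_0 set" where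
  "alg_ints_degree_le n = {x. algebraic_int x \<and> degree_over_rat x \<le> n}"

definition alg_ints_degree_eq :: "nat \<Rightarrow> 'a :: field_char_0 set" where
  "alg_ints_degree_eq n = {x. algebraic_int x \<and> degree_over_rat x = n}"

definition Int_rat :: "'a :: field_char_0 set \<Rightarrow> 'a set \<Rightarrow> rat poly set" where
  "Int_rat A B = {f. \<forall>x\<in>A. rat_poly_eval f x \<in> B}"

lemma min_poly_rat_ex1:
  fixes x :: "'a :: field_char_0"
  assumes "algebraic x"
  shows "\<exists>!p. is_min_poly_rat p x"
proof -
  define Q where "Q = (\<lambda>p :: rat poly. p \<noteq> 0 \<and> rat_poly_eval p x = 0)"
  obtain r :: "int poly" where r: "poly (map_poly of_int r) x = 0" "r \<noteq> 0"
    using algebraicE'[OF assms] by blast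
  have "Q (map_poly of_int r)"
    using r by (auto simp: Q_def map_poly_map_poly o_def poly_eq_iff coeff_map_poly)
  then obtain p0 where p0: "Q p0" "\<And>q. Q q \<Longrightarrow> degree p0 \<le> degree q"
    using ex_has_least_nat[of Q _ degree] by auto
  define p where "p = smult (inverse (lead_coeff p0)) p0"
  have "map_poly of_rat p = smult (of_rat (inverse (lead_coeff p0))) (map_poly of_rat p0 :: 'a poly)"
    by (simp add: p_def poly_eq_iff coeff_map_poly of_rat_mult)
  hence px: "rat_poly_eval p x = 0" using p0(1) by (simp add: Q_def)
  have p: "lead_coeff p = 1" "degree p = degree p0" "p \<noteq> 0"
    using p0(1) by (auto simp: p_def Q_def)
  have least: "degree p \<le> degree q" if "Q q" for q
    using p0(2)[OF that] p(2) by simp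
  have dvd: "p dvd q" if "rat_poly_eval q x = 0" for q
  proof -
    have "rat_poly_eval (q div p * p + q mod p) x = 0"
      using that by simp
    hence "rat_poly_eval (q mod p) x = 0"
      using px by (simp only: rat_poly_eval_add rat_poly_eval_mult) simp
    moreover have "q mod p = 0 \<or> degree (q mod p) < degree p"
      using p(3) by (rule degree_mod_less)
    ultimately have "q mod p = 0"
      using least[of "q mod p"] unfolding Q_def by linarith
    thus ?thesis by auto
  qed
  have nunit: "\<not> is_unit p"
  proof
    assume "is_unit p"
    then obtain c where "p = [:c:]"
      by (auto simp: is_unit_poly_iff)
    with px p(3) show False by (auto simp: map_poly_pCons)
  qed
  have "prime_elem p"
  proof (rule prime_elemI[OF p(3) nunit])
    fix a b assume "p dvd a * b"
    then obtain c where "a * b = p * c" by (elim dvdE)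
    hence "rat_poly_eval a x * rat_poly_eval b x = rat_poly_eval p x * rat_poly_eval c x"
      by (metis rat_poly_eval_mult)
    hence "rat_poly_eval a x = 0 \<or> rat_poly_eval b x = 0" using px by simp
    thus "p dvd a \<or> p dvd b" using dvd by blast
  qed
  hence "irreducible p" by (rule prime_elem_imp_irreducible)
  hence "is_min_poly_rat p x" using p px by (simp add: is_min_poly_rat_def)
  moreover have "q = p" if q: "is_min_poly_rat q x" for q
  proof -
    obtain c where c: "q = p * c"
      using dvd[of q] q by (auto simp: is_min_poly_rat_def elim: dvdE)
    hence "is_unit c" using q nunit
      by (auto simp: is_min_poly_rat_def dest: irreducibleD)
    then obtain d where "c = [:d:]" by (auto simp: is_unit_poly_iff)
    hence qd: "q = smult d p" using c by simp
    have "lead_coeff q = d * lead_coeff p" unfolding qd by (rule lead_coeff_smult)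
    hence "d = 1" using q p(1) by (simp add: is_min_poly_rat_def)
    thus ?thesis using qd by simp
  qed
  ultimately show ?thesis by blast
qed

end

theory Submission
  imports Defs "Berlekamp_Zassenhaus.Factor_Bound" "Jordan_Normal_Form.Char_Poly"
begin

hide_const (open) comm_monoid_mult_class.coprime module.smult up_ring.coeff up_ring.monom

text \<open>
  Let \<open>x\<close> be an algebraic integer of degree at most \<open>n\<close>, let \<open>p\<close> be a monic integer polynomial of
  degree \<open>n\<close> vanishing at \<open>x\<close>, and write \<open>f = F / d\<close> with \<open>F\<close> integral. Some polynomial
  \<open>q = p + d ^ n * h\<close> is irreducible of degree \<open>n\<close>, by Eisenstein's criterion at a prime not dividing
  \<open>d\<close>. For a root \<open>y\<close> of \<open>q\<close>, the number \<open>f(y)\<close> is a root of a monic integer polynomial \<open>g\<close> of degree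
  \<open>k \<le> n\<close>, so \<open>q\<close> divides the integer polynomial \<open>d ^ k * g(F / d)\<close>, say with quotient \<open>s\<close>.
  Evaluating at \<open>x\<close>, where \<open>q(x) = d ^ n * h(x)\<close>, and cancelling \<open>d ^ k\<close> gives
  \<open>g(f(x)) = d ^ (n - k) * h(x) * s(x)\<close>. So \<open>f(x)\<close> is integral over \<open>\<int>[x]\<close>, hence over \<open>\<int>\<close>.
\<close>

section \<open>Polynomial values of integral elements\<close>

lemma monic_division:
  fixes f p :: "'a :: idom poly"
  assumes "lead_coeff p = 1"
  obtains s r where "f = p * s + r" "r = 0 \<or> degree r < degree p"
proof -
  obtain s r where sr: "pseudo_divmod f p = (s, r)" by force
  have "p \<noteq> 0" using assms by auto
  from pseudo_divmod[OF this sr] show ?thesis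
    using assms by (intro that[of s r]) auto
qed

text \<open>
  The annihilating polynomial is the characteristic polynomial of multiplication by \<open>f\<close> on the
  basis \<open>1, X, X\<^sup>2, \<dots>\<close> of the polynomials modulo \<open>p\<close>; the vector of powers of \<open>x\<close> is an eigenvector.
\<close>

lemma monic_annihilator_poly_eval:
  fixes hom :: "'b :: idom \<Rightarrow> 'a :: field" and p f :: "'b poly"
  assumes "comm_ring_hom hom" and monic: "lead_coeff p = 1" and root: "poly (map_poly hom p) x = 0"
  obtains g where "lead_coeff g = 1" "degree g = degree p"
    "poly (map_poly hom g) (poly (map_poly hom f) x) = 0"
proof -
  interpret comm_ring_hom hom by fact
  interpret map_poly_hom: map_poly_comm_ring_hom hom ..
  define m where "m = degree p"
  have m: "m > 0"
  proof (rule ccontr)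
    assume "\<not> m > 0"
    hence "p = 1" using monic by (simp add: m_def monic_degree_0)
    with root show False by simp
  qed
  \<comment> \<open>The remainder of \<open>f * X^i\<close> modulo \<open>p\<close> supplies row
    \<open>i\<close> of the matrix; it agrees with \<open>f * X^i\<close> at \<open>x\<close>
    because \<open>p\<close> vanishes there.\<close>
  have "\<exists>r. (r = 0 \<or> degree r < m) \<and> poly (map_poly hom r) x = poly (map_poly hom f) x * x ^ i" for i
  proof -
    obtain s r where sr: "f * monom 1 i = p * s + r" "r = 0 \<or> degree r < degree p"
      using monic_division[OF monic] by blast
    have "poly (map_poly hom (f * monom 1 i)) x = poly (map_poly hom r) x"
      unfolding sr(1) map_poly_hom.hom_add map_poly_hom.hom_mult using root by simp
    thus ?thesis using sr(2)
      by (intro exI[of _ r]) (auto simp: m_def map_poly_hom.hom_mult map_poly_monom poly_monom)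
  qed
  then obtain r where r: "\<And>i. r i = 0 \<or> degree (r i) < m"
    "\<And>i. poly (map_poly hom (r i)) x = poly (map_poly hom f) x * x ^ i" by metis
  define A where "A = mat m m (\<lambda>(i, j). coeff (r i) j)"
  define v where "v = vec m (\<lambda>i. x ^ i)"
  have A: "A \<in> carrier_mat m m" by (simp add: A_def)
  have "eigenvector (map_mat hom A) v (poly (map_poly hom f) x)"
    unfolding eigenvector_def
  proof (intro conjI)
    show "v \<in> carrier_vec (dim_row (map_mat hom A))" by (simp add: A_def v_def)
    have "v $ 0 = 1" using m by (simp add: v_def)
    thus "v \<noteq> 0\<^sub>v (dim_row (map_mat hom A))" using m by (auto simp: A_def)
    show "map_mat hom A *\<^sub>v v = poly (map_poly hom f) x \<cdot>\<^sub>v v"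
    proof (rule eq_vecI)
      fix i assume "i < dim_vec (poly (map_poly hom f) x \<cdot>\<^sub>v v)"
      hence i: "i < m" by (simp add: v_def)
      have "degree (map_poly hom (r i)) < m"
        using r(1)[of i] m degree_map_poly_le[of hom "r i"] by auto
      hence "poly (map_poly hom (r i)) x = (\<Sum>j<m. coeff (map_poly hom (r i)) j * x ^ j)"
        unfolding poly_altdef
        by (intro sum.mono_neutral_left) (auto simp: coeff_eq_0 simp del: coeff_map_poly_hom)
      thus "(map_mat hom A *\<^sub>v v) $ i = (poly (map_poly hom f) x \<cdot>\<^sub>v v) $ i"
        using i r(2)[of i] by (simp add: A_def v_def scalar_prod_def atLeast0LessThan)
    qed (simp add: A_def v_def)
  qed
  hence "poly (char_poly (map_mat hom A)) (poly (map_poly hom f) x) = 0"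
    using A by (subst eigenvalue_root_char_poly[symmetric, of _ m]) (auto simp: eigenvalue_def)
  moreover have "degree (char_poly A) = m" "lead_coeff (char_poly A) = 1"
    using degree_monic_char_poly[OF A] by auto
  ultimately show ?thesis
    using that[of "char_poly A"] by (simp add: char_poly_hom[OF A] m_def)
qed

lemma algebraic_int_poly_eval:
  fixes x :: "'a :: field_char_0"
  assumes "algebraic_int x"
  shows "algebraic_int (poly (map_poly of_int f) x)"
proof -
  obtain p where "poly (map_poly of_int p) x = 0" "lead_coeff p = 1"
    using assms by (auto simp: algebraic_int_altdef_ipoly)
  then obtain g where "lead_coeff g = 1" "poly (map_poly of_int g) (poly (map_poly of_int f) x) = 0"
    using monic_annihilator_poly_eval[OF of_int_hom.comm_ring_hom_axioms] by metis
  thus ?thesis by (auto simp: algebraic_int_altdef_ipoly)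
qed

section \<open>Irreducible polynomials near a given one\<close>

lemma eisenstein:
  fixes q :: "int poly" and l :: int
  assumes l: "prime l" and monic: "lead_coeff q = 1" and deg: "degree q > 0"
    and dvd: "\<And>i. i < degree q \<Longrightarrow> l dvd coeff q i" and not_dvd: "\<not> l\<^sup>2 dvd coeff q 0"
  shows "irreducible (map_poly rat_of_int q)"
proof -
  \<comment> \<open>Here \<open>l\<close> cannot divide the constant term of \<open>b\<close>. At
    the first coefficient of \<open>a\<close> prime to \<open>l\<close>, exactly one summand of the
    corresponding coefficient of \<open>q\<close> is not divisible by \<open>l\<close>, and its
    index is below \<open>degree q\<close>.\<close>
  have aux: False if q: "q = a * b" and deg_a: "degree a < degree q" and a0: "l dvd coeff a 0" for a b
  proof -
    have b0: "\<not> l dvd coeff b 0"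
      using mult_dvd_mono[OF a0] not_dvd by (auto simp: q coeff_mult_0 power2_eq_square)
    have "lead_coeff a * lead_coeff b = 1" using monic by (simp add: q lead_coeff_mult)
    hence "\<not> l dvd lead_coeff a"
      using l by (metis dvd_mult2 not_prime_unit)
    then obtain i where i: "\<not> l dvd coeff a i" "\<And>j. j < i \<Longrightarrow> l dvd coeff a j" "i \<le> degree a"
      using exists_least_iff[of "\<lambda>i. \<not> l dvd coeff a i"] by (metis not_le_imp_less)
    have "coeff q i = (\<Sum>j<i. coeff a j * coeff b (i - j)) + coeff a i * coeff b 0"
      by (simp add: q coeff_mult lessThan_Suc_atMost[symmetric])
    moreover have "l dvd (\<Sum>j<i. coeff a j * coeff b (i - j))"
      using i(2) by (intro dvd_sum) auto
    moreover have "l dvd coeff q i" using i(3) deg_a by (intro dvd) auto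
    ultimately have "l dvd coeff a i * coeff b 0"
      using dvd_add_right_iff by metis
    with i(1) b0 l show False by (simp add: prime_dvd_mult_iff)
  qed
  have "irreducible\<^sub>d q"
  proof (rule irreducible\<^sub>dI)
    fix a b assume ab: "degree a < degree q" "degree b < degree q" "q = a * b"
    have "l dvd coeff a 0 * coeff b 0" using dvd[OF deg] by (simp add: ab coeff_mult_0)
    hence "l dvd coeff a 0 \<or> l dvd coeff b 0" using l by (simp add: prime_dvd_mult_iff)
    thus False using aux[of a b] aux[of b a] ab by (auto simp: mult.commute)
  qed (use deg in auto)
  \<comment> \<open>Gauss's lemma passes from the integers to the rationals.\<close>
  from irreducible\<^sub>d_int_rat[OF this] show ?thesis by simp
qed

lemma irreducible_perturbation:
  fixes p :: "int poly" and N :: int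
  assumes monic: "lead_coeff p = 1" and deg: "degree p > 0" and N: "N > 0"
  obtains h where "lead_coeff (p + smult N h) = 1" "degree (p + smult N h) = degree p"
    "irreducible (map_poly rat_of_int (p + smult N h))"
proof -
  \<comment> \<open>A prime larger than \<open>N\<close> does not divide \<open>N\<close>, so
    \<open>N\<close> is invertible modulo \<open>l^2\<close>.\<close>
  obtain l' :: nat where l': "prime l'" "l' > nat N" using bigger_prime by blast
  define l where "l = int l'"
  have l: "prime l" "l > N" using l' by (auto simp: l_def)
  have "\<not> l dvd N" using l N zdvd_not_zless by blast
  from prime_imp_coprime[OF l(1) this] have "coprime N (l\<^sup>2)"
    by (simp add: ac_simps)
  then obtain u where "[N * u = 1] (mod l\<^sup>2)" using cong_solve_coprime_int by blast
  then obtain w where uw: "N * u - 1 = l\<^sup>2 * w" by (auto simp: cong_iff_dvd_diff)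
  \<comment> \<open>Since \<open>N * u\<close> is 1 modulo \<open>l\<^sup>2\<close>, moving \<open>p\<close> by \<open>N * u * (t - p)\<close> gives \<open>t\<close> modulo \<open>l\<^sup>2\<close>,
    and \<open>t\<close> is an Eisenstein polynomial.\<close>
  define t where "t = monom 1 (degree p) + [:l:]"
  have t: "lead_coeff t = 1" "degree t = degree p"
    using deg by (auto simp: t_def degree_add_eq_left degree_monom_eq coeff_pCons split: nat.splits)
  define q where "q = p + smult N (smult u (t - p))"
  have "q = t + smult (N * u - 1) (t - p)" by (simp add: q_def smult_diff_left smult_diff_right)
  hence q: "q = t + smult (l\<^sup>2 * w) (t - p)" by (simp add: uw)
  \<comment> \<open>Both \<open>t\<close> and \<open>p\<close> are monic of the same degree, so the
    perturbation leaves the leading term alone.\<close>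
  have low: "coeff (t - p) i = 0" if "i \<ge> degree p" for i
    using that t monic by (cases "i = degree p") (auto simp: coeff_eq_0)
  have top: "coeff q (degree p) = 1" using low[of "degree p"] t by (simp add: q)
  have deg_q: "degree q = degree p"
  proof (rule antisym)
    show "degree q \<le> degree p" by (rule degree_le) (auto simp: q low t coeff_eq_0)
    show "degree p \<le> degree q" by (rule le_degree) (simp add: top)
  qed
  have "irreducible (map_poly rat_of_int q)"
  proof (rule eisenstein[OF l(1)])
    show "l dvd coeff q i" if "i < degree q" for i
    proof -
      have "i < degree p" using that by (simp add: deg_q)
      thus ?thesis by (auto simp: q t_def coeff_pCons power2_eq_square split: nat.splits)
    qed
    show "\<not> l\<^sup>2 dvd coeff q 0"
    proof
      assume "l\<^sup>2 dvd coeff q 0"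
      hence "l\<^sup>2 dvd l + l\<^sup>2 * (w * coeff (t - p) 0)" using deg by (simp add: q t_def mult_ac)
      hence "l * l dvd l * 1" by (simp add: dvd_add_left_iff power2_eq_square)
      hence "l dvd 1" using l N by (subst (asm) dvd_mult_cancel_left) auto
      with l show False using not_prime_unit by blast
    qed
  qed (use deg deg_q top in auto)
  moreover have "lead_coeff q = 1" using top deg_q by simp
  ultimately show ?thesis using deg_q unfolding q_def by (intro that)
qed

section \<open>Minimal polynomials and degrees\<close>

lemma map_poly_of_rat_of_int:
  "map_poly of_rat (map_poly of_int p) = (map_poly of_int p :: 'a :: field_char_0 poly)"
  by (simp add: poly_eq_iff coeff_map_poly)

lemma is_min_poly_rat_min_poly_rat:
  "algebraic x \<Longrightarrow> is_min_poly_rat (min_poly_rat x) x"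
  unfolding min_poly_rat_def by (rule theI') (rule min_poly_rat_ex1)

lemma min_poly_rat_eqI:
  assumes "algebraic x" "is_min_poly_rat p x"
  shows "min_poly_rat x = p"
  using min_poly_rat_ex1[OF assms(1)] is_min_poly_rat_min_poly_rat[OF assms(1)] assms(2) by blast

text \<open>Otherwise the two polynomials are coprime, and a Bezout identity evaluated at
  \<open>x\<close> reads 0 = 1.\<close>

lemma min_poly_rat_dvd:
  assumes "algebraic x" "rat_poly_eval q x = 0"
  shows "min_poly_rat x dvd q"
proof (rule ccontr)
  define m where "m = min_poly_rat x"
  have m: "irreducible m" "rat_poly_eval m x = 0"
    using is_min_poly_rat_min_poly_rat[OF assms(1)] by (auto simp: m_def is_min_poly_rat_def)
  assume "\<not> min_poly_rat x dvd q"
  hence "coprime m q"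
    using m(1) by (simp add: m_def irreducible_imp_prime_elem prime_elem_imp_coprime)
  then obtain a b where "a * m + b * q = 1"
    by (metis bezout_coefficients_fst_snd coprime_imp_gcd_eq_1)
  hence "rat_poly_eval (a * m + b * q) x = 1" by simp
  thus False using m(2) assms(2) by (simp only: rat_poly_eval_add rat_poly_eval_mult) simp
qed

lemma degree_over_rat_le:
  assumes "algebraic x" "rat_poly_eval q x = 0" "q \<noteq> 0"
  shows "degree_over_rat x \<le> degree q"
  unfolding degree_over_rat_def using min_poly_rat_dvd assms by (intro dvd_imp_degree_le) auto

text \<open>The characteristic polynomial construction, now over the rationals and modulo the
  minimal polynomial of \<open>x\<close>, annihilates \<open>f(x)\<close> in the right
  degree.\<close>

lemma degree_over_rat_poly_eval_le:
  assumes "algebraic x" "algebraic (rat_poly_eval f x)"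
  shows "degree_over_rat (rat_poly_eval f x) \<le> degree_over_rat x"
proof -
  have "lead_coeff (min_poly_rat x) = 1" "rat_poly_eval (min_poly_rat x) x = 0"
    using is_min_poly_rat_min_poly_rat[OF assms(1)] by (auto simp: is_min_poly_rat_def)
  then obtain g where g: "lead_coeff g = 1" "degree g = degree_over_rat x"
      "rat_poly_eval g (rat_poly_eval f x) = 0"
    unfolding degree_over_rat_def
    using monic_annihilator_poly_eval[OF of_rat_hom.comm_ring_hom_axioms] by metis
  hence "g \<noteq> 0" by auto
  with degree_over_rat_le[OF assms(2) g(3)] g(2) show ?thesis by simp
qed

text \<open>By Gauss's lemma the primitive integer multiple of the minimal polynomial divides a
  monic integer polynomial, so its leading coefficient is 1 or -1; scaling by that sign makes it
  monic.\<close>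

lemma algebraic_int_min_poly:
  fixes x :: "'a :: field_char_0"
  assumes "algebraic_int x"
  obtains p where "lead_coeff p = 1" "degree p = degree_over_rat x" "poly (map_poly of_int p) x = 0"
proof -
  have x: "algebraic x" using assms by auto
  obtain f where f: "poly (map_poly of_int f) x = 0" "lead_coeff f = 1"
    using assms by (auto simp: algebraic_int_altdef_ipoly)
  have "min_poly_rat x dvd map_poly rat_of_int f"
    by (rule min_poly_rat_dvd[OF x]) (simp add: map_poly_of_rat_of_int f)
  then obtain h where h: "map_poly rat_of_int f = min_poly_rat x * h" by (elim dvdE)
  obtain c p where cp: "rat_to_normalized_int_poly (min_poly_rat x) = (c, p)" by force
  obtain r where "f = p * r" using rat_to_int_factor_explicit[OF h cp] by blast
  hence "is_unit (lead_coeff p)" using f(2) by (metis dvd_triv_left lead_coeff_mult)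
  hence "\<bar>lead_coeff p\<bar> = 1" by simp
  hence lead: "lead_coeff p * lead_coeff p = 1" by (metis abs_mult_self_eq mult_1)
  define q where "q = smult (lead_coeff p) p"
  note c = rat_to_normalized_int_poly[OF cp]
  have "rat_poly_eval (smult c (map_poly of_int p)) x = 0"
    using is_min_poly_rat_min_poly_rat[OF x] c(1) by (simp add: is_min_poly_rat_def)
  hence "poly (map_poly of_int p) x = 0"
    using c(2) by (simp add: of_rat_hom.map_poly_hom_smult map_poly_of_rat_of_int)
  hence "poly (map_poly of_int q) x = 0"
    by (simp add: q_def of_int_hom.map_poly_hom_smult)
  moreover have "lead_coeff q = 1" using lead unfolding q_def lead_coeff_smult .
  moreover have "degree q = degree_over_rat x"
    using lead c(4) by (auto simp: q_def degree_over_rat_def)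
  ultimately show ?thesis using that by blast
qed

lemma alg_ints_degree_eq_root:
  fixes x :: "'a :: field_char_0"
  assumes "lead_coeff q = 1" "irreducible (map_poly rat_of_int q)" "poly (map_poly of_int q) x = 0"
  shows "x \<in> alg_ints_degree_eq (degree q)"
proof -
  have x: "algebraic_int x" using assms by (auto simp: algebraic_int_altdef_ipoly)
  hence "min_poly_rat x = map_poly rat_of_int q"
    using assms by (intro min_poly_rat_eqI) (auto simp: is_min_poly_rat_def map_poly_of_rat_of_int)
  thus ?thesis using x by (simp add: alg_ints_degree_eq_def degree_over_rat_def)
qed

section \<open>Transfer of integrality from \<open>y\<close> to \<open>x\<close>\<close>

text \<open>Division by the monic \<open>q\<close> stays integral, and the remainder vanishes at
  \<open>x\<close> with degree too small to be nonzero.\<close>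

lemma int_poly_dvd_of_root:
  fixes x :: "'a :: field_char_0" and q f :: "int poly"
  assumes monic: "lead_coeff q = 1" and q: "poly (map_poly of_int q) x = 0"
    and deg: "degree_over_rat x = degree q" and f: "poly (map_poly of_int f) x = 0"
  shows "q dvd f"
proof -
  obtain s r where sr: "f = q * s + r" "r = 0 \<or> degree r < degree q"
    using monic_division[OF monic] by blast
  have x: "algebraic x" using monic q algebraic_int_altdef_ipoly[of x] by blast
  have "poly (map_poly of_int r) x = 0"
    using f q by (simp add: sr(1) of_int_poly_hom.hom_add of_int_poly_hom.hom_mult)
  hence "degree q \<le> degree r" if "r \<noteq> 0"
    using degree_over_rat_le[OF x, of "map_poly of_int r"] deg that
    by (simp add: map_poly_of_rat_of_int)
  hence "r = 0" using sr(2) by fastforce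
  with sr(1) show ?thesis by simp
qed

text \<open>Clears denominators in \<open>g(F/d)\<close>. One \<open>H\<close> serves every point,
  since it is used at both \<open>y\<close> and \<open>x\<close>.\<close>

lemma homogenized_pcompose:
  fixes g F :: "int poly" and d :: int
  obtains H where "\<And>x :: 'a :: field_char_0.
    d \<noteq> 0 \<Longrightarrow> poly (map_poly of_int H) x =
      of_int d ^ degree g * poly (map_poly of_int g) (poly (map_poly of_int F) x / of_int d)"
proof
  fix x :: 'a
  define k where "k = degree g"
  define y where "y = poly (map_poly of_int F) x"
  assume d: "d \<noteq> 0"
  let ?H = "\<Sum>i\<le>degree g. smult (coeff g i * d ^ (degree g - i)) (F ^ i)"
  have "poly (map_poly of_int ?H) x = (\<Sum>i\<le>k. of_int (coeff g i) * of_int d ^ (k - i) * y ^ i)"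
    by (simp add: of_int_poly_hom.hom_sum of_int_hom.map_poly_hom_smult of_int_poly_hom.hom_power
        poly_sum k_def y_def)
  also have "\<dots> = (\<Sum>i\<le>k. of_int d ^ k * (of_int (coeff g i) * (y / of_int d) ^ i))"
    using d by (intro sum.cong) (auto simp: power_diff field_simps)
  also have "\<dots> = of_int d ^ k * poly (map_poly of_int g) (y / of_int d)"
    by (simp add: poly_altdef k_def sum_distrib_left)
  finally show "poly (map_poly of_int ?H) x =
    of_int d ^ degree g * poly (map_poly of_int g) (poly (map_poly of_int F) x / of_int d)"
    by (simp add: k_def y_def)
qed

lemma algebraic_int_poly_eval_of_Int_rat:
  fixes x :: "'a :: {alg_closed_field, field_char_0}"
  assumes f: "f \<in> Int_rat (alg_ints_degree_eq n :: 'a set) (alg_ints_degree_le n)"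
    and n: "n > 0" and x: "x \<in> alg_ints_degree_le n"
  shows "algebraic_int (rat_poly_eval f x)"
proof -
  have x: "algebraic_int x" "degree_over_rat x \<le> n" using x by (auto simp: alg_ints_degree_le_def)
  obtain p0 where p0: "lead_coeff p0 = 1" "degree p0 = degree_over_rat x"
    "poly (map_poly of_int p0) x = 0" by (rule algebraic_int_min_poly[OF x(1)])
  \<comment> \<open>A power of X raises the degree to exactly \<open>n\<close> and keeps the root
    \<open>x\<close>.\<close>
  define p where "p = p0 * monom 1 (n - degree_over_rat x)"
  have p0_nz: "p0 \<noteq> 0" using p0(1) by auto
  have "lead_coeff p = lead_coeff p0"
    unfolding p_def lead_coeff_mult by (simp add: degree_monom_eq)
  with p0(1) have p: "lead_coeff p = 1" "degree p = n" "poly (map_poly of_int p) x = 0"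
    using p0(2,3) p0_nz x(2)
    by (simp_all add: p_def degree_mult_eq degree_monom_eq monom_eq_0_iff of_int_poly_hom.hom_mult)
  obtain d F where dF: "rat_to_int_poly f = (d, F)" by force
  have d: "d > 0" using rat_to_int_poly(2)[OF dF] .
  have f_eval: "rat_poly_eval f y = poly (map_poly of_int F) y / of_int d" for y :: 'a
    by (subst rat_to_int_poly(1)[OF dF])
       (simp add: of_rat_hom.map_poly_hom_smult map_poly_of_rat_of_int of_rat_inverse divide_inverse mult.commute)
  \<comment> \<open>The degree of \<open>g\<close> depends on \<open>y\<close>, hence on
    \<open>h\<close>; the exponent \<open>n\<close> bounds it in advance.\<close>
  obtain h where h: "lead_coeff (p + smult (d ^ n) h) = 1" "degree (p + smult (d ^ n) h) = degree p"
    "irreducible (map_poly rat_of_int (p + smult (d ^ n) h))"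
    using irreducible_perturbation[of p "d ^ n"] p n d by auto
  define q where "q = p + smult (d ^ n) h"
  have "\<exists>y :: 'a. poly (map_poly of_int q) y = 0"
    using h(2) p(2) n by (intro alg_closed_imp_poly_has_root) (simp add: q_def)
  then obtain y :: 'a where y: "poly (map_poly of_int q) y = 0" by blast
  have y_deg: "y \<in> alg_ints_degree_eq n"
    using alg_ints_degree_eq_root[of q y] h y p(2) by (simp add: q_def)
  hence "rat_poly_eval f y \<in> alg_ints_degree_le n" using f by (simp add: Int_rat_def)
  hence fy: "algebraic_int (rat_poly_eval f y)" "degree_over_rat (rat_poly_eval f y) \<le> n"
    by (auto simp: alg_ints_degree_le_def)
  obtain g where g: "lead_coeff g = 1" "degree g = degree_over_rat (rat_poly_eval f y)"
    "poly (map_poly of_int g) (rat_poly_eval f y) = 0" by (rule algebraic_int_min_poly[OF fy(1)])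
  have g_deg: "degree g > 0"
  proof (rule ccontr)
    assume "\<not> degree g > 0"
    hence "g = 1" using g(1) by (simp add: monic_degree_0)
    with g(3) show False by simp
  qed
  obtain H where H: "\<And>z :: 'a. poly (map_poly of_int H) z =
      of_int d ^ degree g * poly (map_poly of_int g) (rat_poly_eval f z)"
    using homogenized_pcompose[of d g F] d unfolding f_eval by (metis less_irrefl)
  have "q dvd H"
    using h y y_deg p(2) H[of y] g(3)
    by (intro int_poly_dvd_of_root[of q y]) (auto simp: q_def alg_ints_degree_eq_def)
  then obtain s where s: "H = q * s" by (elim dvdE)
  define R where "R = smult (d ^ (n - degree g)) (h * s)"
  have "of_int d ^ degree g * poly (map_poly of_int g) (rat_poly_eval f x)
      = poly (map_poly of_int (q * s)) x" by (simp only: H flip: s)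
  also have "\<dots> = of_int d ^ n * poly (map_poly of_int (h * s)) x"
    using p(3) by (simp add: q_def of_int_poly_hom.hom_mult of_int_poly_hom.hom_add of_int_hom.map_poly_hom_smult)
  also have "\<dots> = of_int d ^ degree g * poly (map_poly of_int R) x"
    using fy(2) g(2) by (simp add: R_def of_int_hom.map_poly_hom_smult flip: power_add)
  finally have root: "poly (map_poly of_int g) (rat_poly_eval f x) = poly (map_poly of_int R) x"
    using d by simp
  \<comment> \<open>Since \<open>R(x)\<close> is an algebraic integer and \<open>g\<close> is not
    constant, \<open>g - R(x)\<close> is a monic polynomial with integral coefficients and root
    \<open>f(x)\<close>.\<close>
  show ?thesis
  proof (rule algebraic_int_root[OF algebraic_int_poly_eval[OF x(1)] root])
    show "lead_coeff (map_poly of_int g :: 'a poly) = 1" using g(1) by simp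
    show "degree (map_poly of_int g :: 'a poly) > 0" using g_deg by simp
  qed simp
qed

theorem theorem1p2:
  fixes n :: nat
  assumes "\<forall>x :: 'a :: {alg_closed_field, field_char_0}. algebraic x"
    and "n > 0"
  shows "Int_rat (alg_ints_degree_eq n :: 'a set) (alg_ints_degree_le n) =
         Int_rat (alg_ints_degree_le n :: 'a set) (alg_ints_degree_le n)"
proof (intro equalityI subsetI)
  fix f assume f: "f \<in> Int_rat (alg_ints_degree_eq n :: 'a set) (alg_ints_degree_le n)"
  have "rat_poly_eval f x \<in> alg_ints_degree_le n" if x: "x \<in> alg_ints_degree_le n" for x :: 'a
    using algebraic_int_poly_eval_of_Int_rat[OF f assms(2) x]
      degree_over_rat_poly_eval_le[of x f] assms(1) x
    by (force simp: alg_ints_degree_le_def)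
  thus "f \<in> Int_rat (alg_ints_degree_le n :: 'a set) (alg_ints_degree_le n)"
    by (simp add: Int_rat_def)
qed (auto simp: Int_rat_def alg_ints_degree_eq_def alg_ints_degree_le_def)

end
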